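(* For every $A\in\mathrm{ClForm}$: (i) for any $t\in T_A$, $\models^A_{S_\infty}A$ iff $t\models_{S_\infty|t}A$; (ii) for any $t\in T_A$, $\models^V_{S_\infty}A$ iff $t_0\models_{S_\infty|t}A$; (iii) $\models^V_{\mathcal S}A$ iff $\models^V_{\mathcal S_{\mathrm{fin}}}A$.
   Context: $\mathrm{NDE}$ is the set of closed terms generated from $\overline 0$ by a unary symbol $S$ and binary symbols $+$, $\cdot$; for $z\in\mathrm{NDE}$, $[\![z]\!]\in\mathbb N$ is the number it denotes under the standard interpretation. $\mathrm{Eq}=\{x=y: x,y\in\mathrm{NDE}\}$ is the set of formal equations. $\mathrm{ClForm}$ is generated from $\bot$ and $\mathrm{Eq}$ by $\land,\lor,\to$; $\neg A$ abbreviates $A\to\bot$. $S_\infty=\langle T,\le_T,M,E\rangle$ is the following rooted, finitely branching tree, all of whose branches are $\omega$-sequences, with $M:T\to\mathcal P(\mathrm{NDE})$ and $E:T\to\mathcal P(\mathrm{Eq})$. The root $t_0$ has $M(t_0)=\{\overline 0\}$, $E(t_0)=\emptyset$. The direct successors of a node $t$ are the following, for all $x,y\in M(t)$: (1) for $z$ each of $S(x)$, $x+y$, $x\cdot y$ with $z\notin M(t)$, a direct successor $t'$ with $M(t')=M(t)\cup\{z\}$, $E(t')=E(t)$; (2) if $[\![x]\!]=[\![y]\!]$ and $(x=y)\notin E(t)$, a direct successor $t'$ with $M(t')=M(t)$, $E(t')=E(t)\cup\{x=y\}$. Models of strict finitistic arithmetic: tuples $S=\langle T',\le_{T'},M',E'\rangle$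 such that $T'\subseteq T$ is finite; $\le_{T'},M',E'$ are the restrictions of $\le_T,M,E$ to $T'$; $\langle T',\le_{T'}\rangle$ is a tree with a root $t'_0$; each branch of it is $\{t\in T: t'_0\le_T t<_T s\}$ for some $s\in T$; and (atomic prevalence) for every $p\in\mathrm{Eq}$, if $p\in E'(t)$ for some $t\in T'$, then for every $s\in T'$ there is $s'\ge_{T'}s$ with $p\in E'(s')$. $\mathcal S_{\mathrm{fin}}$ is the class of these, and $\mathcal S=\mathcal S_{\mathrm{fin}}\cup\{S_\infty\}$. Forcing $\models_S$ in $S\in\mathcal S$ (quantifying over nodes of $S$, with $E$, $\le$ those of $S$): $t\models_S p$ iff $p\in E(t)$ for $p\in\mathrm{Eq}$; $t\not\models_S\bot$; $t\models_S A\land B$ iff $t\models_S A$ and $t\models_S B$; $t\models_S A\lor B$ iff $t\models_S A$ or $t\models_S B$; $t\models_S A\to B$ iff for every $t'\ge t$ with $t'\models_S A$ there is $t''\ge t'$ with $t''\models_S B$. $\models^V_S A$: $t\models_S A$ for all nodes $t$ of $S$; $\models^A_S A$: $t\models_S A$ for some node $t$ of $S$; for a class $\mathcal S'\subseteq\mathcal S$, $\models^V_{\mathcal S'}A$ means $\models^V_{S}A$ for all $S\in\mathcal S'$. Contraction: for $t\in T$, $S_\infty|t\in\mathcal S_{\mathrm{fin}}$ is the model of arithmetic with node set $\{t'\in T: t_0\le_T t'\le_T t\}$. For $A\in\mathrm{ClForm}$, $\mathrm{Eq}(A)$ is the set of equations occurring in $A$, and $T_A$ is the set of nodes $t\in T$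 such that for all $p\in\mathrm{Eq}(A)$, if $\models^A_{S_\infty}p$ then $t\models_{S_\infty}p$. *)

theory Defs
  imports Main "HOL-Library.Sublist" "HOL-Library.FuncSet"
begin

datatype nde = Zero | Succ nde | Plus nde nde | Times nde nde

primrec denot :: "nde \<Rightarrow> nat" where
  "denot Zero = 0"
| "denot (Succ x) = Suc (denot x)"
| "denot (Plus x y) = denot x + denot y"
| "denot (Times x y) = denot x * denot y"

datatype eqn = Equ nde nde

datatype form = Bot | Atom eqn | And form form | Or form form | Imp form form

primrec Eqs :: "form \<Rightarrow> eqn set" where
  "Eqs Bot = {}"
| "Eqs (Atom p) = {p}"
| "Eqs (And A B) = Eqs A \<union> Eqs B"
| "Eqs (Or A B) = Eqs A \<union> Eqs B"
| "Eqs (Imp A B) = Eqs A \<union> Eqs B"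

record 'n struct =
  nodes :: "'n set"
  leq :: "'n \<Rightarrow> 'n \<Rightarrow> bool"
  terms :: "'n \<Rightarrow> nde set"
  eqns :: "'n \<Rightarrow> eqn set"

primrec forces :: "'n struct \<Rightarrow> 'n \<Rightarrow> form \<Rightarrow> bool" where
  "forces S t Bot \<longleftrightarrow> False"
| "forces S t (Atom p) \<longleftrightarrow> p \<in> eqns S t"
| "forces S t (And A B) \<longleftrightarrow> forces S t A \<and> forces S t B"
| "forces S t (Or A B) \<longleftrightarrow> forces S t A \<or> forces S t B"
| "forces S t (Imp A B) \<longleftrightarrow>
    (\<forall>t'\<in>nodes S. leq S t t' \<longrightarrow> forces S t' A \<longrightarrow>
      (\<exists>t''\<in>nodes S. leq S t' t'' \<and> forces S t'' B))"

definition valid :: "'n struct \<Rightarrow> form \<Rightarrow> bool" where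
  "valid S A \<longleftrightarrow> (\<forall>t\<in>nodes S. forces S t A)"

definition assertible :: "'n struct \<Rightarrow> form \<Rightarrow> bool" where
  "assertible S A \<longleftrightarrow> (\<exists>t\<in>nodes S. forces S t A)"

definition valid_in :: "'n struct set \<Rightarrow> form \<Rightarrow> bool" where
  "valid_in \<S> A \<longleftrightarrow> (\<forall>S\<in>\<S>. valid S A)"

definition restrict_struct :: "'n struct \<Rightarrow> 'n set \<Rightarrow> 'n struct" where
  "restrict_struct S N =
    \<lparr>nodes = N,
     leq = (\<lambda>s t. s \<in> N \<and> t \<in> N \<and> leq S s t),
     terms = restrict (terms S) N,
     eqns = restrict (eqns S) N\<rparr>"

definition rooted_tree :: "'n set \<Rightarrow> ('n \<Rightarrow> 'n \<Rightarrow> bool) \<Rightarrow> 'n \<Rightarrow> bool" where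
  "rooted_tree N le r \<longleftrightarrow>
    reflp_on N le \<and> transp_on N le \<and> antisymp_on N le \<and>
    r \<in> N \<and> (\<forall>t\<in>N. le r t) \<and>
    (\<forall>t\<in>N. totalp_on {s \<in> N. le s t} le)"

text \<open>A node of the infinite tree is encoded as the list of steps leading to it from the root;
  each step records the single term or equation that is added. The tree order is then the prefix
  order. A new compound term determines its immediate subterms, so there is exactly one direct
  successor for each term or equation that can be added.\<close>

datatype step = AddTerm nde | AddEqn eqn

type_synonym node = "step list"

definition M :: "node \<Rightarrow> nde set" where
  "M t = {Zero} \<union> {z. AddTerm z \<in> set t}"

definition E :: "node \<Rightarrow> eqn set" where
  "E t = {p. AddEqn p \<in> set t}"

lemma M_root: "M [] = {Zero}"
  and M_AddTerm: "M (t @ [AddTerm z]) = M t \<union> {z}"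
  and M_AddEqn: "M (t @ [AddEqn p]) = M t"
  and E_root: "E [] = {}"
  and E_AddTerm: "E (t @ [AddTerm z]) = E t"
  and E_AddEqn: "E (t @ [AddEqn p]) = E t \<union> {p}"
  by (auto simp: M_def E_def)

inductive_set T :: "node set" where
  root: "[] \<in> T"
| add_term: "\<lbrakk>t \<in> T; x \<in> M t; y \<in> M t; z \<in> {Succ x, Plus x y, Times x y}; z \<notin> M t\<rbrakk>
    \<Longrightarrow> t @ [AddTerm z] \<in> T"
| add_eqn: "\<lbrakk>t \<in> T; x \<in> M t; y \<in> M t; denot x = denot y; Equ x y \<notin> E t\<rbrakk>
    \<Longrightarrow> t @ [AddEqn (Equ x y)] \<in> T"

abbreviation t0 :: node where
  "t0 \<equiv> []"

definition S_inf :: "node struct" where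
  "S_inf = \<lparr>nodes = T, leq = (\<lambda>s t. s \<in> T \<and> t \<in> T \<and> prefix s t), terms = M, eqns = E\<rparr>"

text \<open>Branches of a finite model are the maximal chains of its own order, whereas the initial
  segment in the branch condition is taken in the infinite tree.\<close>

definition S_fin :: "node struct set" where
  "S_fin = {S.
    nodes S \<subseteq> T \<and> finite (nodes S) \<and>
    S = restrict_struct S_inf (nodes S) \<and>
    (\<exists>r. rooted_tree (nodes S) (leq S) r \<and>
      (\<forall>b. pred_on.maxchain (nodes S) (leq S) b \<longrightarrow>
        (\<exists>s\<in>T. b = {t \<in> T. leq S_inf r t \<and> leq S_inf t s \<and> t \<noteq> s}))) \<and>
    (\<forall>p. (\<exists>t\<in>nodes S. p \<in> eqns S t) \<longrightarrow>
      (\<forall>s\<in>nodes S. \<exists>s'\<in>nodes S. leq S s s' \<and> p \<in> eqns S s'))}"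

definition S_all :: "node struct set" where
  "S_all = S_fin \<union> {S_inf}"

definition contraction :: "node \<Rightarrow> node struct" where
  "contraction t = restrict_struct S_inf {t' \<in> T. leq S_inf t0 t' \<and> leq S_inf t' t}"

definition T_of :: "form \<Rightarrow> node set" where
  "T_of A = {t \<in> T. \<forall>p\<in>Eqs A. assertible S_inf (Atom p) \<longrightarrow> forces S_inf t (Atom p)}"

end

theory Submission
  imports Defs
begin

text \<open>Read every equation classically, as a statement about natural numbers. In the infinite
  tree every true equation can be added above every node, so a formula is assertible iff it is
  classically true, and an implication is forced at an arbitrary node iff it is classically
  true. In the contraction to a node \<open>t\<close> the same holds, because \<open>t\<close> is the
  top node and decides the relevant equations as they are decided classically. Hence the two
  forcing relations agree at the root, where no equation is forced yet.\<close>

section \<open>Classical truth of equations and formulas\<close>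

primrec true_eqn :: "eqn \<Rightarrow> bool" where
  "true_eqn (Equ x y) \<longleftrightarrow> denot x = denot y"

primrec true_form :: "form \<Rightarrow> bool" where
  "true_form Bot \<longleftrightarrow> False"
| "true_form (Atom p) \<longleftrightarrow> true_eqn p"
| "true_form (And A B) \<longleftrightarrow> true_form A \<and> true_form B"
| "true_form (Or A B) \<longleftrightarrow> true_form A \<or> true_form B"
| "true_form (Imp A B) \<longleftrightarrow> (true_form A \<longrightarrow> true_form B)"

lemma S_inf_simps [simp]:
  "nodes S_inf = T"
  "leq S_inf s t \<longleftrightarrow> s \<in> T \<and> t \<in> T \<and> prefix s t"
  "eqns S_inf = E"
  by (simp_all add: S_inf_def)

section \<open>Growth along the infinite tree\<close>

lemma M_mono: "prefix s t \<Longrightarrow> M s \<subseteq> M t"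
  by (auto simp: M_def prefix_def)

lemma E_mono: "prefix s t \<Longrightarrow> E s \<subseteq> E t"
  by (auto simp: E_def prefix_def)

lemma finite_M: "finite (M t)"
proof -
  \<comment> \<open>\<open>AddEqn\<close> steps get the default value \<open>Zero\<close>, which
    lies in the bounding set anyway.\<close>
  have "M t \<subseteq> insert Zero ((\<lambda>s. case s of AddTerm z \<Rightarrow> z | AddEqn p \<Rightarrow> Zero) ` set t)"
    by (force simp: M_def)
  then show ?thesis
    by (rule finite_subset) simp
qed

lemma Zero_in_M: "Zero \<in> M t"
  by (simp add: M_def)

lemma true_eqn_if_in_E: "t \<in> T \<Longrightarrow> p \<in> E t \<Longrightarrow> true_eqn p"
  by (induction rule: T.induct) (auto simp: E_root E_AddTerm E_AddEqn)

lemma extend_by_step: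
  assumes "t \<in> T" "x \<in> M t" "y \<in> M t" "z \<in> {Succ x, Plus x y, Times x y}"
  shows "\<exists>t'\<in>T. prefix t t' \<and> z \<in> M t'"
proof (cases "z \<in> M t")
  case False
  with assms have "t @ [AddTerm z] \<in> T"
    by (blast intro: T.add_term)
  then show ?thesis
    by (intro bexI[of _ "t @ [AddTerm z]"]) (auto simp: M_def)
qed (use assms in auto)

text \<open>The term \<open>y\<close> is collected above a node that already has \<open>x\<close>,
  and \<open>x\<close> stays because \<open>M\<close> grows along the order. Hence both assumptions
  speak of an arbitrary node.\<close>

lemma extend_by_two_terms:
  assumes "t \<in> T"
    and "\<And>t. t \<in> T \<Longrightarrow> \<exists>t'\<in>T. prefix t t' \<and> x \<in> M t'"
    and "\<And>t. t \<in> T \<Longrightarrow> \<exists>t'\<in>T. prefix t t' \<and> y \<in> M t'"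
  shows "\<exists>t'\<in>T. prefix t t' \<and> x \<in> M t' \<and> y \<in> M t'"
  using assms by (meson M_mono prefix_order.trans subsetD)

text \<open>By induction on \<open>z\<close>: its immediate subterms are collected first, so that
  one further step can build \<open>z\<close>.\<close>

lemma extend_by_term: "t \<in> T \<Longrightarrow> \<exists>t'\<in>T. prefix t t' \<and> z \<in> M t'"
proof (induction z arbitrary: t)
  case Zero
  then show ?case
    using Zero_in_M by blast
next
  case (Succ x)
  then obtain t' where "t' \<in> T" "prefix t t'" "x \<in> M t'"
    by blast
  then show ?case
    using extend_by_step[of t' x x "Succ x"] by (blast intro: prefix_order.trans)
next
  case (Plus x y)
  then obtain t' where "t' \<in> T" "prefix t t'" "x \<in> M t'" "y \<in> M t'"
    using extend_by_two_terms by blast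
  then show ?case
    using extend_by_step[of t' x y "Plus x y"] by (blast intro: prefix_order.trans)
next
  case (Times x y)
  then obtain t' where "t' \<in> T" "prefix t t'" "x \<in> M t'" "y \<in> M t'"
    using extend_by_two_terms by blast
  then show ?case
    using extend_by_step[of t' x y "Times x y"] by (blast intro: prefix_order.trans)
qed

lemma extend_by_true_eqn:
  assumes "t \<in> T" "true_eqn p"
  shows "\<exists>t'\<in>T. prefix t t' \<and> p \<in> E t'"
proof -
  obtain x y where p: "p = Equ x y"
    by (cases p)
  obtain t' where t': "t' \<in> T" "prefix t t'" "x \<in> M t'" "y \<in> M t'"
    using extend_by_two_terms[OF assms(1)] extend_by_term by blast
  show ?thesis
  proof (cases "p \<in> E t'")
    case False
    with t' assms p have "t' @ [AddEqn p] \<in> T"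
      by (auto intro: T.add_eqn)
    with t' show ?thesis
      by (intro bexI[of _ "t' @ [AddEqn p]"]) (auto simp: E_AddEqn)
  qed (use t' in auto)
qed

text \<open>The branch condition on finite models asks for a node strictly above each branch; this
  supplies it.\<close>

lemma successor_exists:
  assumes "t \<in> T"
  shows "\<exists>a. t @ [a] \<in> T"
proof -
  \<comment> \<open>A term \<open>x\<close> of maximal size exists as \<open>M t\<close> is finite;
    \<open>Succ x\<close> is larger, hence new.\<close>
  obtain x where x: "x \<in> M t" "\<And>y. y \<in> M t \<Longrightarrow> size y \<le> size x"
    using obtains_MAX[OF finite_M, of t size] Zero_in_M[of t] finite_M[of t]
    by (metis Max_ge empty_iff finite_imageI imageI)
  then have "Succ x \<notin> M t"
    by fastforce
  with assms x(1) show ?thesis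
    by (blast intro: T.add_term)
qed

section \<open>Forcing in the infinite tree\<close>

lemma forces_mono_S_inf:
  "forces S_inf s A \<Longrightarrow> s \<in> T \<Longrightarrow> t \<in> T \<Longrightarrow> prefix s t \<Longrightarrow> forces S_inf t A"
proof (induction A)
  case (Imp A B)
  then show ?case
    by (auto intro: prefix_order.trans)
qed (use E_mono in auto)

text \<open>True equations can be added above any node and false ones never occur. The node
  \<open>s\<close> is arbitrary in the induction because conjunction and implication continue from
  nodes found on the way.\<close>

lemma true_iff_forced_above:
  "s \<in> T \<Longrightarrow> true_form A \<longleftrightarrow> (\<exists>t\<in>T. prefix s t \<and> forces S_inf t A)"
proof (induction A arbitrary: s)
  case (Atom p)
  then show ?case
    using extend_by_true_eqn true_eqn_if_in_E by auto
next
  case (And A B)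
  show ?case
  proof
    assume true: "true_form (And A B)"
    obtain t where t: "t \<in> T" "prefix s t" "forces S_inf t A"
      using true And by auto
    \<comment> \<open>\<open>B\<close> is sought above \<open>t\<close>, where persistence keeps
      \<open>A\<close>.\<close>
    moreover obtain u where u: "u \<in> T" "prefix t u" "forces S_inf u B"
      using true And.IH(2)[OF t(1)] by auto
    ultimately show "\<exists>t\<in>T. prefix s t \<and> forces S_inf t (And A B)"
      using forces_mono_S_inf prefix_order.trans by (metis forces.simps(3))
  next
    assume "\<exists>t\<in>T. prefix s t \<and> forces S_inf t (And A B)"
    then show "true_form (And A B)"
      using And by auto
  qed
next
  case (Imp A B)
  show ?case
  proof
    assume "true_form (Imp A B)"
    \<comment> \<open>The node \<open>s\<close> itself works: a node above it forcing
      \<open>A\<close> shows that \<open>A\<close>, hence \<open>B\<close>, is true, and then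
      \<open>B\<close> is forced further up.\<close>
    then have "forces S_inf s (Imp A B)"
      using Imp.IH by auto
    then show "\<exists>t\<in>T. prefix s t \<and> forces S_inf t (Imp A B)"
      using Imp.prems by blast
  next
    assume "\<exists>t\<in>T. prefix s t \<and> forces S_inf t (Imp A B)"
    then obtain t where t: "t \<in> T" "forces S_inf t (Imp A B)"
      by blast
    show "true_form (Imp A B)"
      unfolding true_form.simps
    proof
      assume "true_form A"
      then obtain u where u: "u \<in> T" "prefix t u" "forces S_inf u A"
        using Imp.IH(1)[OF t(1)] by auto
      then have "\<exists>v\<in>T. prefix u v \<and> forces S_inf v B"
        using t by auto
      then show "true_form B"
        using Imp.IH(2)[OF u(1)] by blast
    qed
  qed
qed auto

lemma assertible_S_inf_iff: "assertible S_inf A \<longleftrightarrow> true_form A"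
  using true_iff_forced_above[OF T.root] by (simp add: assertible_def)

text \<open>An implication only asks whether its two sides are forced somewhere higher up, and the
  answer is the same at all nodes.\<close>

lemma forces_Imp_S_inf_iff:
  assumes "t \<in> T"
  shows "forces S_inf t (Imp A B) \<longleftrightarrow> true_form (Imp A B)"
proof
  assume "forces S_inf t (Imp A B)"
  with assms show "true_form (Imp A B)"
    using true_iff_forced_above[OF assms] by blast
next
  assume "true_form (Imp A B)"
  then show "forces S_inf t (Imp A B)"
    using true_iff_forced_above by auto
qed

lemma valid_S_inf_iff: "valid S_inf A \<longleftrightarrow> forces S_inf t0 A"
  using forces_mono_S_inf T.root by (auto simp: valid_def)

section \<open>Forcing in a contraction\<close>

lemma nodes_contraction: "t \<in> T \<Longrightarrow> nodes (contraction t) = {s \<in> T. prefix s t}"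
  using T.root by (auto simp: contraction_def restrict_struct_def)

lemma leq_contraction:
  assumes "t \<in> T" "s \<in> nodes (contraction t)" "s' \<in> nodes (contraction t)"
  shows "leq (contraction t) s s' \<longleftrightarrow> prefix s s'"
  using assms by (auto simp: contraction_def restrict_struct_def)

lemma eqns_contraction: "s \<in> nodes (contraction t) \<Longrightarrow> eqns (contraction t) s = E s"
  by (simp add: contraction_def restrict_struct_def)

lemma top_in_contraction: "t \<in> T \<Longrightarrow> t \<in> nodes (contraction t)"
  by (simp add: nodes_contraction)

lemma root_in_contraction: "t \<in> T \<Longrightarrow> t0 \<in> nodes (contraction t)"
  by (simp add: nodes_contraction T.root)

lemma forces_contraction_top:
  assumes "t \<in> T"
  shows "forces (contraction t) s A \<Longrightarrow> s \<in> nodes (contraction t) \<Longrightarrow> forces (contraction t) t A"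
proof (induction A)
  case (Atom p)
  then show ?case
    using assms E_mono top_in_contraction[OF assms]
    by (auto simp: eqns_contraction nodes_contraction)
next
  case (Imp A B)
  then show ?case
    using assms top_in_contraction[OF assms]
    by (auto simp: leq_contraction nodes_contraction)
qed auto

text \<open>All nodes lie below \<open>t\<close>, and \<open>t\<close> forces whatever any of them
  forces; so both quantifiers over higher nodes reduce to \<open>t\<close>.\<close>

lemma forces_Imp_contraction_iff:
  assumes "t \<in> T" and s: "s \<in> nodes (contraction t)"
  shows "forces (contraction t) s (Imp A B) \<longleftrightarrow>
    (forces (contraction t) t A \<longrightarrow> forces (contraction t) t B)"
proof -
  note top = top_in_contraction[OF assms(1)]
  have below: "leq (contraction t) u t" if "u \<in> nodes (contraction t)" for u
    using that top assms(1) by (simp add: leq_contraction nodes_contraction)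
  show ?thesis
    unfolding forces.simps using below top s forces_contraction_top[OF assms(1)] by meson
qed

text \<open>Assertible equations are exactly the true ones, and no node contains a false
  one.\<close>

lemma T_of_iff: "t \<in> T_of A \<longleftrightarrow> t \<in> T \<and> (\<forall>p\<in>Eqs A. p \<in> E t \<longleftrightarrow> true_eqn p)"
  by (auto simp: T_of_def assertible_S_inf_iff true_eqn_if_in_E)

text \<open>At the top node every connective is classical, implication included, so only the
  equations matter.\<close>

lemma forces_top_iff:
  assumes "t \<in> T"
  shows "\<forall>p\<in>Eqs A. p \<in> E t \<longleftrightarrow> true_eqn p \<Longrightarrow> forces (contraction t) t A \<longleftrightarrow> true_form A"
proof (induction A)
  case (Atom p)
  then show ?case
    by (simp add: eqns_contraction top_in_contraction assms)
next
  case (Imp A B)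
  then show ?case
    using forces_Imp_contraction_iff[OF assms top_in_contraction[OF assms]]
    by (simp del: forces.simps)
qed auto

text \<open>Both roots contain the same equations and force exactly the true implications;
  conjunction and disjunction are evaluated at the root itself.\<close>

lemma forces_root_iff:
  assumes "t \<in> T"
  shows "\<forall>p\<in>Eqs A. p \<in> E t \<longleftrightarrow> true_eqn p \<Longrightarrow>
    forces (contraction t) t0 A \<longleftrightarrow> forces S_inf t0 A"
proof (induction A)
  case (Atom p)
  then show ?case
    by (simp add: eqns_contraction root_in_contraction assms)
next
  case (Imp A B)
  then show ?case
    using forces_top_iff[OF assms, of A] forces_top_iff[OF assms, of B]
      forces_Imp_contraction_iff[OF assms root_in_contraction[OF assms]]
      forces_Imp_S_inf_iff[OF T.root]
    by (simp del: forces.simps)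
qed auto

section \<open>Nodes deciding finitely many equations\<close>

lemma finite_Eqs: "finite (Eqs A)"
  by (induction A) auto

lemma exists_node_deciding:
  "finite P \<Longrightarrow> \<exists>t\<in>T. \<forall>p\<in>P. p \<in> E t \<longleftrightarrow> true_eqn p"
proof (induction P rule: finite_induct)
  case empty
  then show ?case
    using T.root by blast
next
  case (insert q P)
  then obtain t where t: "t \<in> T" "\<forall>p\<in>P. p \<in> E t \<longleftrightarrow> true_eqn p"
    by blast
  \<comment> \<open>For false \<open>q\<close> the node \<open>t\<close> itself is taken.\<close>
  obtain t' where "t' \<in> T" "prefix t t'" "true_eqn q \<longrightarrow> q \<in> E t'"
    using extend_by_true_eqn[OF t(1)] t(1) by blast
  then have "\<forall>p\<in>insert q P. p \<in> E t' \<longleftrightarrow> true_eqn p"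
    using t true_eqn_if_in_E E_mono by blast
  then show ?case
    using \<open>t' \<in> T\<close> by blast
qed

lemma T_of_nonempty: "\<exists>t. t \<in> T_of A"
  using exists_node_deciding[OF finite_Eqs] by (auto simp: T_of_iff)

section \<open>Contractions as finite models\<close>

lemma rooted_tree_contraction:
  assumes "t \<in> T"
  shows "rooted_tree (nodes (contraction t)) (leq (contraction t)) t0"
  unfolding rooted_tree_def
  using assms root_in_contraction[OF assms]
  by (auto simp: leq_contraction reflp_on_def transp_on_def antisymp_on_def totalp_on_def
      nodes_contraction dest: prefix_order.antisym prefix_order.trans prefix_same_cases)

text \<open>Prefixes of one list are pairwise comparable, so all nodes together form a chain and no
  other chain is maximal.\<close>

lemma maxchain_contraction:
  assumes "t \<in> T" and b: "pred_on.maxchain (nodes (contraction t)) (leq (contraction t)) b"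
  shows "b = nodes (contraction t)"
proof -
  have "pred_on.chain (nodes (contraction t)) (leq (contraction t)) (nodes (contraction t))"
    unfolding pred_on.chain_def
    using assms(1)
    by (auto simp: leq_contraction nodes_contraction dest: prefix_same_cases)
  then show ?thesis
    using b unfolding pred_on.maxchain_def pred_on.chain_def by blast
qed

lemma contraction_in_S_fin:
  assumes "t \<in> T"
  shows "contraction t \<in> S_fin"
proof -
  let ?C = "contraction t"
  have "finite (nodes ?C)"
    using assms finite_subset[of "nodes ?C" "set (prefixes t)"]
    by (simp add: nodes_contraction subset_iff)
  moreover have "?C = restrict_struct S_inf (nodes ?C)"
    by (simp add: contraction_def restrict_struct_def)
  moreover obtain a where a: "t @ [a] \<in> T"
    using successor_exists[OF assms] by blast
  \<comment> \<open>The branch condition excludes its bound \<open>s\<close>, so a successor of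
    \<open>t\<close> is taken as bound rather than \<open>t\<close>.\<close>
  have "nodes ?C = {u \<in> T. leq S_inf t0 u \<and> leq S_inf u (t @ [a]) \<and> u \<noteq> t @ [a]}"
    using assms a T.root by (auto simp: nodes_contraction)
  then have "\<exists>s\<in>T. b = {u \<in> T. leq S_inf t0 u \<and> leq S_inf u s \<and> u \<noteq> s}"
    if "pred_on.maxchain (nodes ?C) (leq ?C) b" for b
    using maxchain_contraction[OF assms that] a by blast
  \<comment> \<open>Atomic prevalence: the top node \<open>t\<close> contains every equation that
    occurs in the model.\<close>
  moreover have "\<exists>s'\<in>nodes ?C. leq ?C s s' \<and> p \<in> eqns ?C s'"
    if "s \<in> nodes ?C" "u \<in> nodes ?C" "p \<in> eqns ?C u" for s u p
    using that assms E_mono top_in_contraction[OF assms]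
    by (intro bexI[of _ t]) (auto simp: leq_contraction eqns_contraction nodes_contraction)
  moreover have "nodes ?C \<subseteq> T"
    using assms by (auto simp: nodes_contraction)
  ultimately show ?thesis
    using rooted_tree_contraction[OF assms] unfolding S_fin_def by blast
qed

theorem proposition10:
  fixes A :: form
  shows "(\<forall>t\<in>T_of A. assertible S_inf A \<longleftrightarrow> forces (contraction t) t A) \<and>
    (\<forall>t\<in>T_of A. valid S_inf A \<longleftrightarrow> forces (contraction t) t0 A) \<and>
    (valid_in S_all A \<longleftrightarrow> valid_in S_fin A)"
proof (intro conjI ballI)
  fix t
  assume "t \<in> T_of A"
  then show "assertible S_inf A \<longleftrightarrow> forces (contraction t) t A"
    by (simp add: T_of_iff assertible_S_inf_iff forces_top_iff)
next
  have root: "valid S_inf A \<longleftrightarrow> forces (contraction t) t0 A" if "t \<in> T_of A" for t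
    using that by (simp add: T_of_iff valid_S_inf_iff forces_root_iff)
  then show "valid S_inf A \<longleftrightarrow> forces (contraction t) t0 A" if "t \<in> T_of A" for t
    using that .
  have "valid S_inf A" if fin: "valid_in S_fin A"
  proof -
    \<comment> \<open>A single contraction suffices: forcing at its root already amounts to validity
      in \<open>S_inf\<close>.\<close>
    obtain t where t: "t \<in> T_of A"
      using T_of_nonempty by blast
    then have "t \<in> T"
      by (simp add: T_of_iff)
    then have "forces (contraction t) t0 A"
      using fin contraction_in_S_fin root_in_contraction by (auto simp: valid_in_def valid_def)
    then show ?thesis
      using root[OF t] by blast
  qed
  then show "valid_in S_all A \<longleftrightarrow> valid_in S_fin A"
    by (auto simp: valid_in_def S_all_def)
qed

end
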